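(* Let $G$ be a totally disconnected, locally compact group, let $\alpha\colon G\to G$ be an automorphism, let $N\subseteq G$ be an $\alpha$-stable closed normal subgroup, and let $\bar{\alpha}\colon G/N\to G/N$, $gN\mapsto \alpha(g)N$, be the automorphism of $G/N$ induced by $\alpha$. Then $\alpha$ is expansive if and only if both $\alpha|_N$ and $\bar{\alpha}$ are expansive.
   Context: All topological groups are Hausdorff. An automorphism of a topological group is a group automorphism $\alpha$ such that both $\alpha$ and $\alpha^{-1}$ are continuous. A subset $H\subseteq G$ is $\alpha$-stable if $\alpha(H)=H$. An automorphism $\alpha$ of a topological group $G$ is called expansive if $\bigcap_{n\in\mathbb{Z}}\alpha^n(U)=\{1\}$ for some identity neighbourhood $U\subseteq G$. *)

theory Defs
  imports "HOL-Analysis.Analysis" "HOL-Algebra.Bij" "HOL-Algebra.Coset"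
begin

section \<open>Topological groups\<close>

locale topological_group = group G
  for G :: "('a, 'b) monoid_scheme" (structure) and T :: "'a topology" +
  assumes topspace_eq: "topspace T = carrier G"
    and continuous_mult: "continuous_map (prod_topology T T) T (\<lambda>(x, y). x \<otimes> y)"
    and continuous_inv: "continuous_map T T (\<lambda>x. inv x)"
    and Hausdorff: "Hausdorff_space T"

definition totally_disconnected_space :: "'a topology \<Rightarrow> bool" where
  "totally_disconnected_space T \<longleftrightarrow>
     (\<forall>x\<in>topspace T. connected_component_of_set T x = {x})"

text \<open>
  \<^const>\<open>AutoGroup\<close> consists of the automorphisms of the abstract group, each represented by the
  unique function that is \<^const>\<open>undefined\<close> outside the carrier; inverses and integer powers
  of automorphisms are taken in that group.
\<close>

definition topological_automorphism ::
    "('a, 'b) monoid_scheme \<Rightarrow> 'a topology \<Rightarrow> ('a \<Rightarrow> 'a) \<Rightarrow> bool" where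
  "topological_automorphism G T \<alpha> \<longleftrightarrow>
     \<alpha> \<in> auto G \<and> continuous_map T T \<alpha> \<and> continuous_map T T (inv\<^bsub>AutoGroup G\<^esub> \<alpha>)"

definition identity_neighbourhood ::
    "('a, 'b) monoid_scheme \<Rightarrow> 'a topology \<Rightarrow> 'a set \<Rightarrow> bool" where
  "identity_neighbourhood G T U \<longleftrightarrow>
     U \<subseteq> carrier G \<and> (\<exists>V. openin T V \<and> \<one>\<^bsub>G\<^esub> \<in> V \<and> V \<subseteq> U)"

definition expansive ::
    "('a, 'b) monoid_scheme \<Rightarrow> 'a topology \<Rightarrow> ('a \<Rightarrow> 'a) \<Rightarrow> bool" where
  "expansive G T \<alpha> \<longleftrightarrow>
     (\<exists>U. identity_neighbourhood G T U \<and>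
          (\<Inter>n::int. (\<alpha> [^]\<^bsub>AutoGroup G\<^esub> n) ` U) = {\<one>\<^bsub>G\<^esub>})"


section \<open>Quotients\<close>

definition quotient_topology :: "'a topology \<Rightarrow> ('a \<Rightarrow> 'b) \<Rightarrow> 'b topology" where
  "quotient_topology T f =
     topology (\<lambda>V. V \<subseteq> f ` topspace T \<and> openin T {x \<in> topspace T. f x \<in> V})"

lemma openin_quotient_topology:
  "openin (quotient_topology T f) V \<longleftrightarrow>
     V \<subseteq> f ` topspace T \<and> openin T {x \<in> topspace T. f x \<in> V}"
proof -
  have "istopology (\<lambda>V. V \<subseteq> f ` topspace T \<and> openin T {x \<in> topspace T. f x \<in> V})"
    unfolding istopology_def
  proof (intro conjI allI impI)
    fix A B
    assume A: "A \<subseteq> f ` topspace T \<and> openin T {x \<in> topspace T. f x \<in> A}"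
      and B: "B \<subseteq> f ` topspace T \<and> openin T {x \<in> topspace T. f x \<in> B}"
    then show "A \<inter> B \<subseteq> f ` topspace T" by blast
    have "{x \<in> topspace T. f x \<in> A \<inter> B} =
        {x \<in> topspace T. f x \<in> A} \<inter> {x \<in> topspace T. f x \<in> B}" by blast
    then show "openin T {x \<in> topspace T. f x \<in> A \<inter> B}"
      using A B by (simp add: openin_Int)
  next
    fix \<K>
    assume K: "\<forall>K\<in>\<K>. K \<subseteq> f ` topspace T \<and> openin T {x \<in> topspace T. f x \<in> K}"
    then show "\<Union>\<K> \<subseteq> f ` topspace T" by blast
    have "{x \<in> topspace T. f x \<in> \<Union>\<K>} = (\<Union>K\<in>\<K>. {x \<in> topspace T. f x \<in> K})" by blast
    moreover have "openin T (\<Union>K\<in>\<K>. {x \<in> topspace T. f x \<in> K})"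
      using K by (intro openin_Union) blast
    ultimately show "openin T {x \<in> topspace T. f x \<in> \<Union>\<K>}" by simp
  qed
  then show ?thesis
    by (simp add: quotient_topology_def topology_inverse')
qed

lemma topspace_quotient_topology: "topspace (quotient_topology T f) = f ` topspace T"
proof
  show "topspace (quotient_topology T f) \<subseteq> f ` topspace T"
    using openin_topspace[of "quotient_topology T f"]
    unfolding openin_quotient_topology by blast
  have "{x \<in> topspace T. f x \<in> f ` topspace T} = topspace T" by blast
  then have "openin (quotient_topology T f) (f ` topspace T)"
    by (simp add: openin_quotient_topology)
  then show "f ` topspace T \<subseteq> topspace (quotient_topology T f)"
    by (rule openin_subset)
qed

lemma quotient_map_quotient_topology: "quotient_map T (quotient_topology T f) f"
  by (simp add: quotient_map_def topspace_quotient_topology openin_quotient_topology)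

text \<open>\<^const>\<open>FactGroup\<close> uses right cosets; for normal \<open>N\<close> these are the left cosets.\<close>

definition coset_topology ::
    "('a, 'b) monoid_scheme \<Rightarrow> 'a topology \<Rightarrow> 'a set \<Rightarrow> 'a set topology" where
  "coset_topology G T N = quotient_topology T (\<lambda>g. N #>\<^bsub>G\<^esub> g)"

text \<open>
  If \<open>\<alpha>\<close> is an automorphism with \<open>\<alpha> ` N = N\<close>, the cosets in the following union
  all coincide.
\<close>

definition induced_automorphism ::
    "('a, 'b) monoid_scheme \<Rightarrow> 'a set \<Rightarrow> ('a \<Rightarrow> 'a) \<Rightarrow> 'a set \<Rightarrow> 'a set" where
  "induced_automorphism G N \<alpha> = (\<lambda>X\<in>carrier (G Mod N). \<Union>x\<in>X. N #>\<^bsub>G\<^esub> \<alpha> x)"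

lemma inv_AutoGroup:
  assumes "group G" and "\<alpha> \<in> auto G"
  shows "inv\<^bsub>AutoGroup G\<^esub> \<alpha> = restrict (inv_into (carrier G) \<alpha>) (carrier G)"
proof -
  interpret group G by fact
  have "inv\<^bsub>AutoGroup G\<^esub> \<alpha> = inv\<^bsub>BijGroup (carrier G)\<^esub> \<alpha>"
    unfolding AutoGroup_def
    using group.m_inv_consistent[OF group_BijGroup subgroup_auto assms(2)] .
  then show ?thesis
    using assms(2) by (simp add: inv_BijGroup auto_def)
qed

lemma induced_automorphism_r_coset:
  assumes "N \<lhd> G" and "\<alpha> \<in> auto G" and "\<alpha> ` N = N" and "g \<in> carrier G"
  shows "induced_automorphism G N \<alpha> (N #>\<^bsub>G\<^esub> g) = N #>\<^bsub>G\<^esub> \<alpha> g"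
proof -
  interpret normal N G by fact
  have hom: "\<alpha> \<in> hom G G" using assms(2) by (simp add: auto_def)
  have ag: "\<alpha> g \<in> carrier G" using hom assms(4) by (rule hom_in_carrier)
  have eq: "N #>\<^bsub>G\<^esub> \<alpha> x = N #>\<^bsub>G\<^esub> \<alpha> g" if x: "x \<in> N #>\<^bsub>G\<^esub> g" for x
  proof -
    obtain h where h: "h \<in> N" "x = h \<otimes>\<^bsub>G\<^esub> g" using x by (auto simp: r_coset_def)
    have "\<alpha> x = \<alpha> h \<otimes>\<^bsub>G\<^esub> \<alpha> g"
      using h assms(4) hom by (simp add: hom_mult)
    moreover have "\<alpha> h \<in> N" using h assms(3) by blast
    ultimately have "\<alpha> x \<in> N #>\<^bsub>G\<^esub> \<alpha> g" by (auto simp: r_coset_def)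
    then show ?thesis
      using repr_independence[OF _ ag] subgroup_axioms by metis
  qed
  have "g \<in> N #>\<^bsub>G\<^esub> g" using assms(4) by (rule rcos_self[OF _ subgroup_axioms])
  then have ne: "N #>\<^bsub>G\<^esub> g \<noteq> {}" by blast
  have "N #>\<^bsub>G\<^esub> g \<in> carrier (G Mod N)"
    using assms(4) unfolding carrier_FactGroup by (rule imageI)
  then have "induced_automorphism G N \<alpha> (N #>\<^bsub>G\<^esub> g) = (\<Union>x\<in>N #>\<^bsub>G\<^esub> g. N #>\<^bsub>G\<^esub> \<alpha> x)"
    unfolding induced_automorphism_def by (rule restrict_apply')
  also have "\<dots> = (\<Union>x\<in>N #>\<^bsub>G\<^esub> g. N #>\<^bsub>G\<^esub> \<alpha> g)"
    using eq by (rule SUP_cong[OF refl])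
  also have "\<dots> = N #>\<^bsub>G\<^esub> \<alpha> g"
    using ne by (rule cSUP_const)
  finally show ?thesis .
qed

lemma induced_automorphism_l_coset:
  assumes "N \<lhd> G" and "\<alpha> \<in> auto G" and "\<alpha> ` N = N" and "g \<in> carrier G"
  shows "induced_automorphism G N \<alpha> (g <#\<^bsub>G\<^esub> N) = \<alpha> g <#\<^bsub>G\<^esub> N"
proof -
  interpret normal N G by fact
  have "\<alpha> g \<in> carrier G"
    using assms(2,4) by (auto simp: auto_def intro: hom_in_carrier)
  then show ?thesis
    using induced_automorphism_r_coset[OF assms] coset_eq assms(4) by simp
qed

lemma topological_automorphism_restrict:
  fixes G (structure)
  assumes "topological_group G T" and "topological_automorphism G T \<alpha>"
    and "subgroup N G" and "\<alpha> ` N = N"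
  shows "topological_automorphism (G\<lparr>carrier := N\<rparr>) (subtopology T N) (restrict \<alpha> N)"
proof -
  interpret topological_group G T by fact
  let ?H = "G\<lparr>carrier := N\<rparr>"
  have NG: "N \<subseteq> carrier G" using assms(3) by (rule subgroup.subset)
  have a: "\<alpha> \<in> auto G" "continuous_map T T \<alpha>" "continuous_map T T (inv\<^bsub>AutoGroup G\<^esub> \<alpha>)"
    using assms(2) by (auto simp: topological_automorphism_def)
  have inj: "inj_on \<alpha> (carrier G)"
    using a(1) by (auto simp: auto_def Bij_def bij_betw_def)
  have mult: "\<alpha> (x \<otimes> y) = \<alpha> x \<otimes> \<alpha> y" if "x \<in> N" "y \<in> N" for x y
    using that a(1) NG by (auto simp: auto_def intro!: hom_mult)
  have bij: "bij_betw (restrict \<alpha> N) N N"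
    using inj_on_subset[OF inj NG] assms(4) by (auto simp: bij_betw_def)
  have auto: "restrict \<alpha> N \<in> auto ?H"
    using mult bij assms(4) subgroup.m_closed[OF assms(3)]
    by (auto simp: auto_def hom_def Bij_def)
  have inv_eq: "(inv\<^bsub>AutoGroup ?H\<^esub> (restrict \<alpha> N)) x = (inv\<^bsub>AutoGroup G\<^esub> \<alpha>) x" if x: "x \<in> N" for x
  proof -
    obtain y where y: "y \<in> N" "x = \<alpha> y" using x assms(4) by blast
    have "inv_into N (restrict \<alpha> N) x = y"
      using bij y by (metis bij_betw_inv_into_left restrict_apply')
    moreover have "inv_into (carrier G) \<alpha> x = y"
      using inj y NG by auto
    ultimately show ?thesis
      using x NG
      by (auto simp: inv_AutoGroup[OF is_group a(1)]
            inv_AutoGroup[OF subgroup.subgroup_is_group[OF assms(3) is_group] auto])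
  qed
  have top: "topspace (subtopology T N) = N" using NG by (auto simp: topspace_eq)
  have inv_N: "(inv\<^bsub>AutoGroup G\<^esub> \<alpha>) x \<in> N" if x: "x \<in> N" for x
  proof -
    obtain y where y: "y \<in> N" "x = \<alpha> y" using x assms(4) by blast
    moreover have "\<alpha> y \<in> carrier G" using x y(2) NG by blast
    ultimately show ?thesis
      using inj NG by (auto simp: inv_AutoGroup[OF is_group a(1)])
  qed
  have "continuous_map (subtopology T N) (subtopology T N) (restrict \<alpha> N)"
  proof (rule continuous_map_eq)
    show "continuous_map (subtopology T N) (subtopology T N) \<alpha>"
      using a(2) assms(4) top
      by (auto simp: continuous_map_in_subtopology continuous_map_from_subtopology)
  qed (simp add: top)
  moreover have "continuous_map (subtopology T N) (subtopology T N)
      (inv\<^bsub>AutoGroup ?H\<^esub> (restrict \<alpha> N))"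
  proof (rule continuous_map_eq)
    show "continuous_map (subtopology T N) (subtopology T N) (inv\<^bsub>AutoGroup G\<^esub> \<alpha>)"
      using a(3) inv_N top
      by (auto simp: continuous_map_in_subtopology continuous_map_from_subtopology)
  qed (simp add: top inv_eq)
  ultimately show ?thesis
    using auto by (simp add: topological_automorphism_def)
qed

lemma topological_automorphism_induced:
  fixes G (structure)
  assumes "topological_group G T" and "topological_automorphism G T \<alpha>"
    and "N \<lhd> G" and "\<alpha> ` N = N"
  shows "topological_automorphism (G Mod N) (coset_topology G T N) (induced_automorphism G N \<alpha>)"
proof -
  interpret topological_group G T by fact
  interpret N: normal N G by fact
  let ?b = "inv\<^bsub>AutoGroup G\<^esub> \<alpha>"
  let ?p = "\<lambda>g. N #> g"
  let ?A = "induced_automorphism G N \<alpha>" and ?B = "induced_automorphism G N ?b"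
  have a: "\<alpha> \<in> auto G" "continuous_map T T \<alpha>" "continuous_map T T ?b"
    using assms(2) by (auto simp: topological_automorphism_def)
  have bij: "bij_betw \<alpha> (carrier G) (carrier G)"
    using a(1) by (simp add: auto_def Bij_def)
  have b: "?b \<in> auto G"
    using group.inv_closed[OF AutoGroup] a(1) by (simp add: AutoGroup_def)
  have ba: "?b (\<alpha> x) = x" "\<alpha> (?b x) = x" if "x \<in> carrier G" for x
    using that bij bij_betw_apply[OF bij that]
    by (auto simp: inv_AutoGroup[OF is_group a(1)] bij_betw_inv_into_left bij_betw_inv_into_right)
  have bN: "?b ` N = N"
  proof -
    have "?b ` N = ?b ` \<alpha> ` N" using assms(4) by simp
    also have "\<dots> = N" using ba(1) N.subset by (force simp: image_image)
    finally show ?thesis .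
  qed
  note A = induced_automorphism_r_coset[OF assms(3) a(1) assms(4)]
  note B = induced_automorphism_r_coset[OF assms(3) b bN]
  have ac: "\<alpha> x \<in> carrier G" "?b x \<in> carrier G" if "x \<in> carrier G" for x
    using that a(1) b by (auto simp: auto_def intro: hom_in_carrier)
  have AB: "?B (?A X) = X" "?A (?B X) = X" "?A X \<in> carrier (G Mod N)" "?B X \<in> carrier (G Mod N)"
    if "X \<in> carrier (G Mod N)" for X
    using that by (auto simp: carrier_FactGroup A B ac ba)
  have bijA: "bij_betw ?A (carrier (G Mod N)) (carrier (G Mod N))"
    by (rule bij_betw_byWitness[where f' = ?B]) (use AB in auto)
  have "?A (X <#> Y) = ?A X <#> ?A Y"
    if XY: "X \<in> carrier (G Mod N)" "Y \<in> carrier (G Mod N)" for X Y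
  proof -
    obtain x y where xy: "x \<in> carrier G" "y \<in> carrier G" "X = N #> x" "Y = N #> y"
      using XY by (auto simp: carrier_FactGroup)
    have "\<alpha> (x \<otimes> y) = \<alpha> x \<otimes> \<alpha> y"
      using a(1) xy(1,2) by (auto simp: auto_def intro!: hom_mult)
    then show ?thesis
      using xy(1,2) ac(1) A[OF m_closed[OF xy(1,2)]] by (simp add: xy(3,4) N.rcos_sum A)
  qed
  then have autA: "?A \<in> auto (G Mod N)"
    using bijA AB(3)
    by (simp add: auto_def hom_def Bij_def Pi_iff) (simp add: induced_automorphism_def)
  have invA: "(inv\<^bsub>AutoGroup (G Mod N)\<^esub> ?A) X = ?B X" if "X \<in> carrier (G Mod N)" for X
  proof -
    have "inv_into (carrier (G Mod N)) ?A X = ?B X"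
      using that AB bijA by (metis bij_betw_inv_into_left)
    then show ?thesis
      using that by (simp add: inv_AutoGroup[OF N.factorgroup_is_group autA])
  qed
  have q: "quotient_map T (coset_topology G T N) ?p"
    unfolding coset_topology_def by (rule quotient_map_quotient_topology)
  have top: "topspace (coset_topology G T N) = carrier (G Mod N)"
    by (simp add: coset_topology_def topspace_quotient_topology topspace_eq carrier_FactGroup)
  have cont: "continuous_map (coset_topology G T N) (coset_topology G T N)
      (induced_automorphism G N c)"
    if "continuous_map T T c" "\<And>g. g \<in> carrier G \<Longrightarrow> induced_automorphism G N c (N #> g) = N #> c g"
    for c
  proof -
    have "continuous_map T (coset_topology G T N) (?p \<circ> c)"
      using that(1) quotient_imp_continuous_map[OF q] by (rule continuous_map_compose)
    then have "continuous_map T (coset_topology G T N) (induced_automorphism G N c \<circ> ?p)"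
      by (rule continuous_map_eq) (simp add: that(2) topspace_eq)
    then show ?thesis
      using continuous_compose_quotient_map_eq[OF q] by blast
  qed
  have "continuous_map (coset_topology G T N) (coset_topology G T N) ?A"
    using a(2) A by (rule cont)
  moreover have "continuous_map (coset_topology G T N) (coset_topology G T N)
      (inv\<^bsub>AutoGroup (G Mod N)\<^esub> ?A)"
  proof (rule continuous_map_eq)
    show "continuous_map (coset_topology G T N) (coset_topology G T N) ?B"
      using a(3) B by (rule cont)
  qed (simp add: top invA)
  ultimately show ?thesis
    using autA by (simp add: topological_automorphism_def)
qed

end

theory Submission
  imports Defs
begin

text \<open>
  Only the expansiveness of the quotient is difficult. Choose a compact open subgroup \<open>W\<close> in
  which no nontrivial element of \<open>G\<close> has its whole orbit. The compact group \<open>K = N \<inter> W\<close>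
  satisfies \<open>K' = K\<^sub>- K\<^sub>+\<close>, where \<open>K' = \<alpha> K \<inter> \<dots> \<inter> \<alpha>\<^sup>m K\<close> for some \<open>m\<close> and \<open>K\<^sub>-\<close>, \<open>K\<^sub>+\<close>
  consist of the elements of \<open>K'\<close> whose forward, respectively backward, orbit stays in \<open>K'\<close>.
  If the orbit of \<open>xN\<close> stays close to \<open>N\<close>, then
  it lifts to a pseudo-orbit in \<open>W\<close> whose errors lie in \<open>K'\<close>, and the factorization allows
  correcting the errors inside \<open>N\<close>, giving an element of \<open>xN\<close> whose whole orbit is in \<open>W\<close>.
  This element is trivial, so \<open>x \<in> N\<close>.
\<close>

section \<open>Nested compact sets and compact open sets\<close>

text \<open>If no \<open>C n\<close> were contained in \<open>A\<close>, the sets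
  \<open>C n - A\<close> would form a nest of nonempty closed subsets of the compact
  \<open>K\<close> and would have a common point, lying in the intersection but not in
  \<open>A\<close>.\<close>

lemma decseq_compactin_subset_open:
  fixes C :: "nat \<Rightarrow> 'a set"
  assumes dec: "decseq C" and closed: "\<And>n. closedin T (C n)" and K: "compactin T K"
    and sub: "C 0 \<subseteq> K" and A: "openin T A" "(\<Inter>n. C n) \<subseteq> A"
  obtains n where "C n \<subseteq> A"
proof -
  have le: "C n \<subseteq> K" for n
    using decseqD[OF dec, of 0 n] sub by auto
  have "\<exists>n. C n - A = {}"
  proof (rule ccontr)
    assume "\<not> ?thesis"
    then have ne: "C n - A \<noteq> {}" for n by blast
    have cl: "closedin (subtopology T K) (C n - A)" for n
      using closedin_diff[OF closed A(1)] le by (intro closedin_subset_topspace) auto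
    have "decseq (\<lambda>n. C n - A)"
      using dec by (auto simp: decseq_def)
    then have "(\<Inter>n. C n - A) \<noteq> {}"
      using compact_space_imp_nest[OF compact_space_subtopology[OF K], of "\<lambda>n. C n - A"] cl ne
      by blast
    then show False using A(2) by blast
  qed
  then show ?thesis using that by blast
qed

text \<open>The preceding lemma for the complement of \<open>D\<close>. It turns solutions at every
  finite stage into one solution for all stages.\<close>

lemma decseq_compactin_meets_closed:
  fixes C :: "nat \<Rightarrow> 'a set"
  assumes dec: "decseq C" and closed: "\<And>n. closedin T (C n)" and K: "compactin T K"
    and sub: "C 0 \<subseteq> K" and D: "closedin T D" and meets: "\<And>n. D \<inter> C n \<noteq> {}"
  shows "D \<inter> (\<Inter>n. C n) \<noteq> {}"
proof
  assume "D \<inter> (\<Inter>n. C n) = {}"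
  then have "(\<Inter>n. C n) \<subseteq> topspace T - D"
    using closedin_subset[OF closed] by blast
  then obtain n where "C n \<subseteq> topspace T - D"
    using decseq_compactin_subset_open[OF dec closed K sub] D by blast
  then show False using meets[of n] by blast
qed

text \<open>Inside a compact neighbourhood \<open>K\<close> of \<open>x\<close>, connected sets
  through \<open>x\<close> are trivial, so the cut-wire fence theorem yields a relatively clopen
  \<open>C\<close> separating \<open>x\<close> from \<open>K - A\<close>.\<close>

lemma totally_disconnected_compact_open_base:
  assumes "totally_disconnected_space T" "locally_compact_space T" "Hausdorff_space T"
    and "openin T U" "x \<in> U"
  obtains C where "openin T C" "compactin T C" "x \<in> C" "C \<subseteq> U"
proof -
  have "neighbourhood_base_of (compactin T) T"
    using assms(2,3) by (simp add: locally_compact_space_neighbourhood_base)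
  then obtain A K where AK: "openin T A" "compactin T K" "x \<in> A" "A \<subseteq> K" "K \<subseteq> U"
    using assms(4,5) unfolding neighbourhood_base_of by metis
  define X where "X = subtopology T K"
  have KT: "K \<subseteq> topspace T" using AK(2) by (rule compactin_subset_topspace)
  have top: "topspace X = K" using KT by (auto simp: X_def)
  have Kcl: "closedin T K" using AK(2) assms(3) by (rule compactin_imp_closedin[rotated])
  have "compact_space X" using AK(2) unfolding X_def by (rule compact_space_subtopology)
  moreover have "Hausdorff_space X"
    unfolding X_def using assms(3) by (rule Hausdorff_space_subtopology)
  moreover have "compactin X {x}" using AK top by auto
  moreover have "closedin X (K - A)"
    unfolding X_def using closedin_diff[OF Kcl AK(1)] by (intro closedin_subset_topspace) auto
  moreover have "disjnt D {x} \<or> disjnt D (K - A)" if D: "connectedin X D" for D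
  proof (cases "x \<in> D")
    case True
    have "connectedin T D" using D by (simp add: X_def connectedin_subtopology)
    then have "D \<subseteq> connected_component_of_set T x"
      using True by (rule connected_component_of_maximal)
    also have "\<dots> = {x}"
      using assms(1) AK KT by (auto simp: totally_disconnected_space_def)
    finally show ?thesis using AK(3) by (auto simp: disjnt_def)
  qed (auto simp: disjnt_def)
  ultimately have "separated_between X {x} (K - A)"
    by (intro cut_wire_fence_theorem_gen) auto
  then obtain C where C: "closedin X C" "openin X C" "{x} \<subseteq> C" "K - A \<subseteq> topspace X - C"
    unfolding separated_between by blast
  have CA: "C \<subseteq> A" using C(2,4) openin_subset[OF C(2)] top by blast
  obtain B where B: "openin T B" "C = B \<inter> K"
    using C(2) by (auto simp: X_def openin_subtopology)
  \<comment> \<open>\<open>C\<close> is only known to be open relative to \<open>K\<close>; lying in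
    the open set \<open>A \<subseteq> K\<close> makes it open in \<open>T\<close>.\<close>
  then have "C = B \<inter> A" using CA AK(4) by blast
  then have "openin T C" using B(1) AK(1) by auto
  moreover have "closedin T C"
    using C(1) Kcl unfolding X_def by (rule closedin_trans_full)
  then have "compactin T C"
    using AK(2,4) CA by (meson closed_compactin subset_trans)
  ultimately show ?thesis using that C(3) CA AK by blast
qed

section \<open>Open subgroups of topological groups\<close>

context topological_group
begin

lemma continuous_map_mult:
  assumes "continuous_map X T f" "continuous_map X T g"
  shows "continuous_map X T (\<lambda>x. f x \<otimes> g x)"
  using continuous_map_compose[OF _ continuous_mult, of X "\<lambda>x. (f x, g x)"] assms
  by (simp add: continuous_map_pairedI o_def)

lemma homeomorphic_map_l_translation:
  assumes "a \<in> carrier G"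
  shows "homeomorphic_map T T (\<lambda>x. a \<otimes> x)"
proof -
  have "continuous_map T T (\<lambda>x. b \<otimes> x)" if "b \<in> carrier G" for b
    using that by (intro continuous_map_mult) (auto simp: topspace_eq)
  then have "homeomorphic_maps T T (\<lambda>x. a \<otimes> x) (\<lambda>x. inv a \<otimes> x)"
    using assms by (auto simp: homeomorphic_maps_def topspace_eq m_assoc[symmetric])
  then show ?thesis by (auto simp: homeomorphic_map_maps)
qed

lemma openin_l_translate:
  "openin T U \<Longrightarrow> a \<in> carrier G \<Longrightarrow> openin T ((\<lambda>x. a \<otimes> x) ` U)"
  using homeomorphic_map_openness_eq[OF homeomorphic_map_l_translation] openin_subset by metis

lemma closedin_l_translate:
  "closedin T U \<Longrightarrow> a \<in> carrier G \<Longrightarrow> closedin T ((\<lambda>x. a \<otimes> x) ` U)"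
  using homeomorphic_map_closedness_eq[OF homeomorphic_map_l_translation] closedin_subset by metis

text \<open>A subgroup is the union of its translates of any of its subsets that contains the
  identity.\<close>

lemma openin_subgroupI:
  assumes H: "subgroup H G" and V: "openin T V" "\<one> \<in> V" "V \<subseteq> H"
  shows "openin T H"
proof -
  have "H = (\<Union>h\<in>H. (\<lambda>x. h \<otimes> x) ` V)"
  proof
    show "H \<subseteq> (\<Union>h\<in>H. (\<lambda>x. h \<otimes> x) ` V)"
      using V(2) subgroup.mem_carrier[OF H] by force
    show "(\<Union>h\<in>H. (\<lambda>x. h \<otimes> x) ` V) \<subseteq> H"
      using V(3) subgroup.m_closed[OF H] by blast
  qed
  moreover have "openin T (\<Union>h\<in>H. (\<lambda>x. h \<otimes> x) ` V)"
    using openin_l_translate[OF V(1)] subgroup.mem_carrier[OF H] by blast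
  ultimately show ?thesis by simp
qed

text \<open>The complement is a union of left cosets, each of them open.\<close>

lemma closedin_open_subgroup:
  assumes H: "subgroup H G" and "openin T H"
  shows "closedin T H"
proof -
  interpret H: subgroup H G by fact
  have "carrier G - H = (\<Union>a\<in>carrier G - H. (\<lambda>x. a \<otimes> x) ` H)"
  proof
    show "carrier G - H \<subseteq> (\<Union>a\<in>carrier G - H. (\<lambda>x. a \<otimes> x) ` H)"
    proof
      fix a assume a: "a \<in> carrier G - H"
      then have "a = a \<otimes> \<one>" by simp
      then show "a \<in> (\<Union>a\<in>carrier G - H. (\<lambda>x. a \<otimes> x) ` H)" using a H.one_closed by blast
    qed
    show "(\<Union>a\<in>carrier G - H. (\<lambda>x. a \<otimes> x) ` H) \<subseteq> carrier G - H"
    proof clarify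
      fix a h assume a: "a \<in> carrier G" "a \<notin> H" and h: "h \<in> H"
      have "a \<in> H" if "a \<otimes> h \<in> H"
        using H.m_closed[OF that H.m_inv_closed[OF h]] a h by (simp add: m_assoc)
      then show "a \<otimes> h \<in> carrier G - H" using a h by auto
    qed
  qed
  moreover have "openin T (\<Union>a\<in>carrier G - H. (\<lambda>x. a \<otimes> x) ` H)"
    using openin_l_translate[OF assms(2)] by blast
  ultimately show ?thesis
    by (simp add: closedin_def topspace_eq H.subset)
qed

text \<open>
  Van Dantzig's theorem. The subgroup consists of the elements whose right translations map
  a compact open set \<open>C\<close> onto itself; the tube lemma makes it a neighbourhood of the identity.
\<close>

lemma compact_open_subgroup_base:
  assumes "totally_disconnected_space T" "locally_compact_space T"
    and "openin T U" "\<one> \<in> U"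
  obtains W where "subgroup W G" "openin T W" "compactin T W" "W \<subseteq> U"
proof -
  obtain C where C: "openin T C" "compactin T C" "\<one> \<in> C" "C \<subseteq> U"
    using totally_disconnected_compact_open_base[OF assms(1,2) Hausdorff assms(3,4)] by blast
  have CG: "C \<subseteq> carrier G" using openin_subset[OF C(1)] by (simp add: topspace_eq)
  define W where
    "W = {x \<in> carrier G. (\<forall>c\<in>C. c \<otimes> x \<in> C) \<and> (\<forall>c\<in>C. c \<otimes> inv x \<in> C)}"
  have W: "subgroup W G"
  proof (rule subgroupI)
    show "W \<subseteq> carrier G" by (auto simp: W_def)
    show "W \<noteq> {}" using CG by (auto simp: W_def intro!: exI[of _ \<one>])
    show "inv a \<in> W" if "a \<in> W" for a using that by (auto simp: W_def)
    show "a \<otimes> b \<in> W" if "a \<in> W" "b \<in> W" for a b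
    proof -
      have "c \<otimes> (a \<otimes> b) = (c \<otimes> a) \<otimes> b" "c \<otimes> inv (a \<otimes> b) = (c \<otimes> inv b) \<otimes> inv a"
        if "c \<in> C" for c
        using that \<open>a \<in> W\<close> \<open>b \<in> W\<close> CG by (auto simp: W_def m_assoc inv_mult_group)
      then show ?thesis using that by (auto simp: W_def)
    qed
  qed
  \<comment> \<open>As \<open>\<one> \<in> C\<close>, translating \<open>\<one>\<close> by
    \<open>x\<close> gives \<open>x\<close> itself; this puts \<open>W\<close> inside the compact
    set \<open>C\<close>.\<close>
  have "W \<subseteq> C"
  proof
    fix x assume "x \<in> W"
    then have "\<one> \<otimes> x \<in> C" "x \<in> carrier G" using C(3) by (auto simp: W_def simp del: l_one)
    then show "x \<in> C" by simp
  qed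
  let ?P = "{p \<in> topspace (prod_topology T T). fst p \<otimes> snd p \<in> C}"
  let ?Q = "{p \<in> topspace (prod_topology T T). fst p \<otimes> inv (snd p) \<in> C}"
  have "continuous_map (prod_topology T T) T (\<lambda>p. fst p \<otimes> snd p)"
    by (intro continuous_map_mult continuous_map_fst continuous_map_snd)
  then have P: "openin (prod_topology T T) ?P"
    using C(1) by (rule openin_continuous_map_preimage)
  have "continuous_map (prod_topology T T) T (\<lambda>p. fst p \<otimes> inv (snd p))"
    using continuous_map_compose[OF continuous_map_snd continuous_inv]
    by (intro continuous_map_mult continuous_map_fst) (auto simp: o_def)
  then have Q: "openin (prod_topology T T) ?Q"
    using C(1) by (rule openin_continuous_map_preimage)
  have "C \<times> {\<one>} \<subseteq> ?P \<inter> ?Q" using CG by (auto simp: topspace_eq)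
  moreover have "compactin T {\<one>}" by (simp add: topspace_eq)
  ultimately obtain A V where AV: "openin T V" "C \<subseteq> A" "{\<one>} \<subseteq> V" "A \<times> V \<subseteq> ?P \<inter> ?Q"
    by (elim Wallace_theorem_prod_topology[OF C(2) _ openin_Int[OF P Q], rotated])
  have "V \<subseteq> W"
  proof
    fix v assume v: "v \<in> V"
    then have "v \<in> carrier G" using openin_subset[OF AV(1)] by (auto simp: topspace_eq)
    moreover have "c \<otimes> v \<in> C \<and> c \<otimes> inv v \<in> C" if "c \<in> C" for c
      using that v AV(2,4) by fastforce
    ultimately show "v \<in> W" by (simp add: W_def)
  qed
  then have "openin T W"
    using openin_subgroupI[OF W AV(1)] AV(3) by blast
  moreover have "compactin T W"
    using closed_compactin[OF C(2) \<open>W \<subseteq> C\<close>] closedin_open_subgroup[OF W] \<open>openin T W\<close> by blast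
  ultimately show ?thesis using that W \<open>W \<subseteq> C\<close> C(4) by blast
qed

end

section \<open>Integer powers of automorphisms and expansiveness\<close>

context group
begin

lemma auto_int_pow_in_auto:
  "\<alpha> \<in> auto G \<Longrightarrow> \<alpha> [^]\<^bsub>AutoGroup G\<^esub> (n::int) \<in> auto G"
  using group.int_pow_closed[OF AutoGroup, of \<alpha> n] by (simp add: AutoGroup_def)

lemma auto_int_pow_add:
  assumes "\<alpha> \<in> auto G" "x \<in> carrier G"
  shows "(\<alpha> [^]\<^bsub>AutoGroup G\<^esub> (m + n :: int)) x =
    (\<alpha> [^]\<^bsub>AutoGroup G\<^esub> m) ((\<alpha> [^]\<^bsub>AutoGroup G\<^esub> n) x)"
proof -
  have "\<alpha> [^]\<^bsub>AutoGroup G\<^esub> (m + n) =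
      \<alpha> [^]\<^bsub>AutoGroup G\<^esub> m \<otimes>\<^bsub>AutoGroup G\<^esub> \<alpha> [^]\<^bsub>AutoGroup G\<^esub> n"
    using assms(1) by (intro group.int_pow_mult[OF AutoGroup]) (simp add: AutoGroup_def)
  also have "\<dots> = compose (carrier G) (\<alpha> [^]\<^bsub>AutoGroup G\<^esub> m) (\<alpha> [^]\<^bsub>AutoGroup G\<^esub> n)"
    using auto_int_pow_in_auto[OF assms(1)]
    by (simp add: AutoGroup_def BijGroup_def auto_def)
  finally show ?thesis using assms(2) by (simp add: compose_eq)
qed

lemma auto_int_pow_0:
  "x \<in> carrier G \<Longrightarrow> (\<alpha> [^]\<^bsub>AutoGroup G\<^esub> (0::int)) x = x"
  by (simp add: AutoGroup_def BijGroup_def)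

lemma auto_int_pow_1:
  "\<alpha> \<in> auto G \<Longrightarrow> \<alpha> [^]\<^bsub>AutoGroup G\<^esub> (1::int) = \<alpha>"
  by (rule group.int_pow_1[OF AutoGroup]) (simp add: AutoGroup_def)

lemma auto_apply_closed:
  "\<alpha> \<in> auto G \<Longrightarrow> x \<in> carrier G \<Longrightarrow> \<alpha> x \<in> carrier G"
  by (auto simp: auto_def intro: hom_in_carrier)

lemma auto_int_pow_closed:
  "\<alpha> \<in> auto G \<Longrightarrow> x \<in> carrier G \<Longrightarrow> (\<alpha> [^]\<^bsub>AutoGroup G\<^esub> (n::int)) x \<in> carrier G"
  by (rule auto_apply_closed[OF auto_int_pow_in_auto])

lemma auto_int_pow_neg_cancel:
  assumes "\<alpha> \<in> auto G" "x \<in> carrier G"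
  shows "(\<alpha> [^]\<^bsub>AutoGroup G\<^esub> (- n :: int)) ((\<alpha> [^]\<^bsub>AutoGroup G\<^esub> n) x) = x"
  using auto_int_pow_add[OF assms, of "- n" n] auto_int_pow_0[OF assms(2)] by simp

text \<open>Applied to the inclusion of \<open>N\<close> and to the projection onto the quotient,
  this expresses the iterates of the restricted and the induced automorphism through those of
  \<open>\<alpha>\<close>.\<close>

lemma auto_int_pow_intertwine:
  assumes "group H" "\<alpha> \<in> auto G" "\<beta> \<in> auto H" "\<phi> \<in> carrier G \<rightarrow> carrier H"
    and comm: "\<And>x. x \<in> carrier G \<Longrightarrow> \<phi> (\<alpha> x) = \<beta> (\<phi> x)"
    and x: "x \<in> carrier G"
  shows "\<phi> ((\<alpha> [^]\<^bsub>AutoGroup G\<^esub> (n::int)) x) = (\<beta> [^]\<^bsub>AutoGroup H\<^esub> n) (\<phi> x)"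
proof (induction n rule: int_induct[where k = 0])
  interpret H: group H by fact
  let ?a = "\<lambda>n::int. \<alpha> [^]\<^bsub>AutoGroup G\<^esub> n" and ?b = "\<lambda>n::int. \<beta> [^]\<^bsub>AutoGroup H\<^esub> n"
  have fx: "\<phi> x \<in> carrier H" using x assms(4) by blast
  have ax: "?a n x \<in> carrier G" for n using assms(2) x by (rule auto_int_pow_closed)
  have stepG: "?a (1 + n) x = \<alpha> (?a n x)" for n
    using auto_int_pow_add[OF assms(2) x, of 1 n] assms(2) by (simp add: auto_int_pow_1)
  have stepH: "?b (1 + n) (\<phi> x) = \<beta> (?b n (\<phi> x))" for n
    using H.auto_int_pow_add[OF assms(3) fx, of 1 n] assms(3) by (simp add: H.auto_int_pow_1)
  { case base
    then show ?case by (simp only: auto_int_pow_0[OF x] H.auto_int_pow_0[OF fx]) }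
  { case (step1 n)
    then show ?case
      using stepG[of n] stepH[of n] comm[OF ax] by (simp add: add.commute) }
  \<comment> \<open>For the step backwards, both sides are compared after applying the injective map
    \<open>\<beta>\<close>.\<close>
  { case (step2 n)
    have "\<beta> (\<phi> (?a (n - 1) x)) = \<phi> (?a n x)"
      using stepG[of "n - 1"] comm[OF ax] by simp
    also have "\<dots> = \<beta> (?b (n - 1) (\<phi> x))"
      using step2 stepH[of "n - 1"] by simp
    finally show ?case
    proof (rule inj_onD[rotated])
      show "inj_on \<beta> (carrier H)"
        using assms(3) by (auto simp: auto_def Bij_def bij_betw_def)
      show "\<phi> (?a (n - 1) x) \<in> carrier H" using ax assms(4) by blast
      show "?b (n - 1) (\<phi> x) \<in> carrier H" using assms(3) fx by (rule H.auto_int_pow_closed)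
    qed }
qed

text \<open>Since \<open>x\<close> lies in the image of \<open>U\<close> under the power
  \<open>n\<close> iff the power \<open>- n\<close> maps \<open>x\<close> into \<open>U\<close>, the
  intersection over all integers is the set of points whose whole orbit stays in
  \<open>U\<close>.\<close>

lemma expansive_iff:
  assumes a: "\<alpha> \<in> auto G"
  shows "expansive G T \<alpha> \<longleftrightarrow> (\<exists>U. identity_neighbourhood G T U \<and>
    (\<forall>x\<in>carrier G. (\<forall>n::int. (\<alpha> [^]\<^bsub>AutoGroup G\<^esub> n) x \<in> U) \<longrightarrow> x = \<one>))"
proof -
  let ?a = "\<lambda>n::int. \<alpha> [^]\<^bsub>AutoGroup G\<^esub> n"
  have "(\<Inter>n. ?a n ` U) = {\<one>} \<longleftrightarrow> (\<forall>x\<in>carrier G. (\<forall>n. ?a n x \<in> U) \<longrightarrow> x = \<one>)"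
    if U: "identity_neighbourhood G T U" for U
  proof -
    have UG: "U \<subseteq> carrier G" and 1: "\<one> \<in> U" using U by (auto simp: identity_neighbourhood_def)
    have "(\<Inter>n. ?a n ` U) = {x \<in> carrier G. \<forall>n. ?a n x \<in> U}"
    proof (rule equalityI; rule subsetI)
      fix x assume x: "x \<in> (\<Inter>n. ?a n ` U)"
      have "?a n x \<in> U" for n
      proof -
        obtain u where u: "u \<in> U" "x = ?a (- n) u" using x by blast
        have "u \<in> carrier G" using u(1) UG by blast
        then have "?a (- (- n)) x = u"
          unfolding u(2) by (rule auto_int_pow_neg_cancel[OF a])
        then show ?thesis using u(1) by simp
      qed
      moreover have "x \<in> carrier G"
      proof -
        obtain u where u: "u \<in> U" "x = ?a 0 u" using x by blast
        show ?thesis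
          unfolding u(2) using subsetD[OF UG u(1)] by (rule auto_int_pow_closed[OF a])
      qed
      ultimately show "x \<in> {x \<in> carrier G. \<forall>n. ?a n x \<in> U}" by blast
    next
      fix x assume x: "x \<in> {x \<in> carrier G. \<forall>n. ?a n x \<in> U}"
      have "x = ?a n (?a (- n) x)" for n
        using auto_int_pow_neg_cancel[OF a, of x "- n"] x by simp
      then show "x \<in> (\<Inter>n. ?a n ` U)" using x by blast
    qed
    moreover have "?a n \<one> = \<one>" for n
      using auto_int_pow_in_auto[OF a] hom_one[OF _ is_group is_group] by (auto simp: auto_def)
    ultimately show ?thesis using 1 by auto
  qed
  then show ?thesis unfolding expansive_def by metis
qed

end

section \<open>Iterates of a topological automorphism\<close>

locale topological_group_automorphism = topological_group +
  fixes \<alpha>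
  assumes automorphism: "topological_automorphism G T \<alpha>"
begin

definition iter :: "int \<Rightarrow> 'a \<Rightarrow> 'a" where
  "iter n = \<alpha> [^]\<^bsub>AutoGroup G\<^esub> n"

lemma in_auto: "\<alpha> \<in> auto G"
  using automorphism by (simp add: topological_automorphism_def)

lemma iter_closed [simp]: "x \<in> carrier G \<Longrightarrow> iter n x \<in> carrier G"
  unfolding iter_def using in_auto by (rule auto_int_pow_closed)

lemma iter_add: "x \<in> carrier G \<Longrightarrow> iter (m + n) x = iter m (iter n x)"
  unfolding iter_def using in_auto by (rule auto_int_pow_add)

lemma iter_iter [simp]: "x \<in> carrier G \<Longrightarrow> iter m (iter n x) = iter (m + n) x"
  by (rule iter_add[symmetric])

lemma iter_0 [simp]: "x \<in> carrier G \<Longrightarrow> iter 0 x = x"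
  unfolding iter_def by (rule auto_int_pow_0)

lemma iter_1: "iter 1 = \<alpha>"
  unfolding iter_def using in_auto by (rule auto_int_pow_1)

lemma iter_step: "x \<in> carrier G \<Longrightarrow> \<alpha> (iter n x) = iter (n + 1) x"
  using iter_add[of x 1 n] by (simp only: iter_1 add.commute)

lemma iter_hom: "iter n \<in> hom G G"
  using auto_int_pow_in_auto[OF in_auto] by (simp add: auto_def iter_def)

lemma iter_mult [simp]:
  "x \<in> carrier G \<Longrightarrow> y \<in> carrier G \<Longrightarrow> iter n (x \<otimes> y) = iter n x \<otimes> iter n y"
  using iter_hom by (rule hom_mult)

lemma iter_one [simp]: "iter n \<one> = \<one>"
  using iter_hom is_group is_group by (rule hom_one)

lemma iter_inv [simp]: "x \<in> carrier G \<Longrightarrow> iter n (inv x) = inv (iter n x)"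
  using group_hom.hom_inv[of G G "iter n" x] iter_hom
  by (simp add: group_hom_def group_hom_axioms_def is_group)

lemma continuous_map_iter: "continuous_map T T (iter n)"
proof (induction n rule: int_induct[where k = 0])
  case base
  show ?case by (rule continuous_map_eq[OF continuous_map_id]) (simp add: topspace_eq)
next
  case (step1 n)
  have "continuous_map T T (\<alpha> \<circ> iter n)"
    using automorphism
    by (intro continuous_map_compose[OF step1(2)]) (simp add: topological_automorphism_def)
  then show ?case
    by (rule continuous_map_eq) (simp add: topspace_eq iter_step)
next
  case (step2 n)
  have inv_iter: "inv\<^bsub>AutoGroup G\<^esub> \<alpha> = iter (- 1)"
    using group.int_pow_neg[OF AutoGroup, of \<alpha> 1] in_auto auto_int_pow_1[OF in_auto]
    unfolding iter_def by (simp add: AutoGroup_def)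
  have "continuous_map T T (iter (- 1))"
    using automorphism unfolding topological_automorphism_def inv_iter by blast
  then have "continuous_map T T (iter (- 1) \<circ> iter n)"
    by (rule continuous_map_compose[OF step2(2)])
  then show ?case
    by (rule continuous_map_eq) (simp add: topspace_eq)
qed

lemma iter_image_subset:
  assumes "\<alpha> ` N = N" "N \<subseteq> carrier G" "x \<in> N"
  shows "iter n x \<in> N"
proof (induction n rule: int_induct[where k = 0])
  case base
  then show ?case using assms by auto
next
  case (step1 n)
  have "iter (n + 1) x = \<alpha> (iter n x)"
    using assms(2,3) by (intro iter_step[symmetric]) blast
  then show ?case using step1 assms(1) by auto
next
  case (step2 n)
  obtain y where y: "y \<in> N" "iter n x = \<alpha> y" using step2(2) assms(1) by blast
  have "iter (n - 1) x = iter (- 1) (iter n x)" using assms(2,3) by auto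
  also have "\<dots> = iter (- 1) (iter 1 y)" by (simp only: y(2) iter_1)
  also have "\<dots> = y" using y(1) assms(2) by auto
  finally show ?case using y(1) by simp
qed

section \<open>Orbits confined to a set during given times\<close>

text \<open>The groups \<open>K'\<close>, \<open>K\<^sub>+\<close> and \<open>K\<^sub>-\<close>
  described at the start are \<open>stay K {- int m..<0}\<close>, \<open>stay K {..<0}\<close> and
  \<open>stay K {- int m..}\<close>: the image of \<open>K\<close> under the power \<open>k\<close>
  is given by the time \<open>- k\<close>.\<close>

definition stay :: "'a set \<Rightarrow> int set \<Rightarrow> 'a set" where
  "stay K I = {x \<in> carrier G. \<forall>i\<in>I. iter i x \<in> K}"

lemma stayI: "x \<in> carrier G \<Longrightarrow> (\<And>i. i \<in> I \<Longrightarrow> iter i x \<in> K) \<Longrightarrow> x \<in> stay K I"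
  by (simp add: stay_def)

lemma stayD: "x \<in> stay K I \<Longrightarrow> i \<in> I \<Longrightarrow> iter i x \<in> K"
  by (simp add: stay_def)

lemma stay_carrier: "x \<in> stay K I \<Longrightarrow> x \<in> carrier G"
  by (simp add: stay_def)

lemma stay_mono: "K \<subseteq> L \<Longrightarrow> J \<subseteq> I \<Longrightarrow> stay K I \<subseteq> stay L J"
  by (auto simp: stay_def)

lemma stay_antimono: "x \<in> stay K I \<Longrightarrow> J \<subseteq> I \<Longrightarrow> x \<in> stay K J"
  by (auto simp: stay_def)

lemma stay_extend:
  assumes "x \<in> stay K {a..<b}" "iter b x \<in> K"
  shows "x \<in> stay K {a..<b + 1}"
proof (rule stayI)
  show "x \<in> carrier G" using assms(1) by (rule stay_carrier)
  fix i assume "i \<in> {a..<b + 1}"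
  then have "i = b \<or> i \<in> {a..<b}" by auto
  then show "iter i x \<in> K" using assms(2) stayD[OF assms(1)] by blast
qed

lemma stay_Union: "(\<Inter>n. stay K (I n)) = stay K (\<Union>n. I n)"
  by (auto simp: stay_def)

lemma subgroup_stay:
  assumes "subgroup K G"
  shows "subgroup (stay K I) G"
proof -
  interpret K: subgroup K G by fact
  show ?thesis by (rule subgroupI) (auto simp: stay_def intro!: exI[of _ \<one>])
qed

lemma closedin_stay:
  assumes "closedin T K"
  shows "closedin T (stay K I)"
proof -
  have "stay K I = topspace T \<inter> (\<Inter>i\<in>I. {x \<in> topspace T. iter i x \<in> K})"
    by (auto simp: stay_def topspace_eq)
  moreover have "closedin T (topspace T \<inter> (\<Inter>i\<in>I. {x \<in> topspace T. iter i x \<in> K}))"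
    using closedin_continuous_map_preimage[OF continuous_map_iter assms]
    by (cases "I = {}") (auto intro!: closedin_Int closedin_Inter)
  ultimately show ?thesis by simp
qed

lemma openin_stay:
  assumes "openin T K" "finite I"
  shows "openin T (stay K I)"
proof -
  have "stay K I = topspace T \<inter> (\<Inter>i\<in>I. {x \<in> topspace T. iter i x \<in> K})"
    by (auto simp: stay_def topspace_eq)
  moreover have "openin T (topspace T \<inter> (\<Inter>i\<in>I. {x \<in> topspace T. iter i x \<in> K}))"
    using openin_continuous_map_preimage[OF continuous_map_iter assms(1)] assms(2)
    by (cases "I = {}") (auto intro!: openin_Int openin_Inter)
  ultimately show ?thesis by simp
qed

text \<open>The set is closed and lies in the compact image of \<open>K\<close> under
  \<open>iter (- i)\<close>; an empty \<open>I\<close> would give the whole group.\<close>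

lemma compactin_stay:
  assumes "compactin T K" "i \<in> I"
  shows "compactin T (stay K I)"
proof (rule closed_compactin)
  show "compactin T (iter (- i) ` K)"
    using assms(1) continuous_map_iter by (rule image_compactin)
  show "stay K I \<subseteq> iter (- i) ` K"
  proof
    fix x assume x: "x \<in> stay K I"
    then have "x = iter (- i) (iter i x)" using stay_carrier by simp
    then show "x \<in> iter (- i) ` K" using stayD[OF x assms(2)] by blast
  qed
  show "closedin T (stay K I)"
    using compactin_imp_closedin[OF Hausdorff assms(1)] by (rule closedin_stay)
qed

section \<open>Factorization of compact subgroups and lifting of orbits modulo
  \<open>N\<close>\<close>

text \<open>
  Willis' tidying-above factorization. Put \<open>K\<^sub>m = \<Inter>{\<alpha>\<^sup>k K | 0 \<le> k \<le> m}\<close>, so that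
  \<open>\<alpha> K\<^sub>m = stay K {- m - 1..<0}\<close>. By compactness some \<open>\<alpha> K\<^sub>m\<close> lies in the open set
  \<open>\<alpha> (\<Inter>m. K\<^sub>m) W\<close>; the factorization obtained from this is then propagated forward in time.
\<close>

lemma tidy_factorization:
  assumes K: "subgroup K G" "compactin T K" and W: "openin T W" "\<one> \<in> W"
    and sub: "iter 1 ` K \<inter> W \<subseteq> K"
  obtains m :: nat where "m > 0"
    "\<And>z. z \<in> stay K {- int m..<0} \<Longrightarrow> \<exists>y\<in>stay K {..<0}. inv y \<otimes> z \<in> stay K {- int m..}"
proof -
  note grp = subgroup_stay[OF K(1)]
  have cl: "closedin T (stay K I)" for I
    using compactin_imp_closedin[OF Hausdorff K(2)] by (rule closedin_stay)
  let ?P = "stay K {..<0}"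
  define A where "A = (\<Union>y\<in>?P. (\<lambda>x. y \<otimes> x) ` W)"
  have WG: "W \<subseteq> carrier G" using openin_subset[OF W(1)] by (simp add: topspace_eq)
  have A: "openin T A"
    unfolding A_def using openin_l_translate[OF W(1)] stay_carrier by blast
  have PA: "?P \<subseteq> A"
  proof
    fix y assume y: "y \<in> ?P"
    then have "y = y \<otimes> \<one>" using stay_carrier by simp
    then show "y \<in> A" using y W(2) unfolding A_def by blast
  qed
  have Un: "(\<Union>n. {- int (Suc n)..<0}) = {..<0}"
  proof -
    have "i \<in> {- int (Suc (nat (- i)))..<0}" if "i < 0" for i using that by simp
    then show ?thesis by fastforce
  qed
  have "decseq (\<lambda>n. stay K {- int (Suc n)..<0})"
    unfolding decseq_def by (intro allI impI stay_mono) auto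
  moreover have "compactin T (stay K {- int (Suc 0)..<0})"
    using compactin_stay[OF K(2), of "- 1"] by simp
  moreover have "(\<Inter>n. stay K {- int (Suc n)..<0}) \<subseteq> A"
    unfolding stay_Union Un by (rule PA)
  ultimately obtain n where n: "stay K {- int (Suc n)..<0} \<subseteq> A"
    using decseq_compactin_subset_open[OF _ cl _ subset_refl A,
        of "\<lambda>n. {- int (Suc n)..<0}"] by blast
  \<comment> \<open>The successor makes \<open>m\<close> positive, so the window
    \<open>{- int m..<0}\<close> contains the time \<open>- 1\<close>.\<close>
  define m where "m = Suc n"
  \<comment> \<open>After shifting time \<open>k\<close> to \<open>0\<close>, a factor from
    \<open>?P\<close> is split off on the left. The rest \<open>w\<close> lies in \<open>W\<close>
    and in the image of \<open>K\<close> under \<open>\<alpha>\<close>, hence in \<open>K\<close>,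
    which gains the time \<open>k\<close>.\<close>
  have step: "\<exists>y\<in>stay K {..<k}. inv y \<otimes> z \<in> stay K {k - int m..<k + 1}"
    if z: "z \<in> stay K {k - int m..<k}" for z k
  proof -
    have zG: "z \<in> carrier G" using z by (rule stay_carrier)
    have kz: "iter k z \<in> stay K {- int m..<0}"
      using z by (auto simp: stay_def)
    then have "iter k z \<in> A" using n by (auto simp: m_def)
    then obtain y w where y: "y \<in> ?P" and w: "w \<in> W" "iter k z = y \<otimes> w"
      unfolding A_def by blast
    have yG: "y \<in> carrier G" using y by (rule stay_carrier)
    have wG: "w \<in> carrier G" using w(1) WG by blast
    have weq: "w = inv y \<otimes> iter k z"
      using w(2) yG wG by (simp add: m_assoc[symmetric])
    have "y \<in> stay K {- int m..<0}" using y by (rule stay_antimono) auto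
    then have ws: "w \<in> stay K {- int m..<0}"
      unfolding weq using subgroup.m_closed[OF grp subgroup.m_inv_closed[OF grp] kz] by blast
    have "iter (- 1) w \<in> K" using stayD[OF ws, of "- 1"] by (simp add: m_def)
    moreover have "w = iter 1 (iter (- 1) w)" using wG by simp
    ultimately have "w \<in> K" using w(1) sub by blast
    then have ws': "w \<in> stay K {- int m..<1}"
      using stay_extend[OF ws] wG by simp
    have "iter (- k) y \<in> stay K {..<k}"
      using y yG by (auto simp: stay_def)
    moreover have "inv (iter (- k) y) \<otimes> z = iter (- k) w"
      using yG zG by (simp add: weq)
    moreover have "iter (- k) w \<in> stay K {k - int m..<k + 1}"
      using ws' wG by (auto simp: stay_def)
    ultimately show ?thesis by metis
  qed
  \<comment> \<open>The left factors from \<open>step\<close> at successive times are collected in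
    one \<open>y\<close>; each application uses only the last \<open>m\<close> times.\<close>
  have fwd: "\<exists>y\<in>?P. inv y \<otimes> z \<in> stay K {- int m..<int k}"
    if z: "z \<in> stay K {- int m..<0}" for z and k :: nat
  proof (induction k)
    case 0
    show ?case using z subgroup.one_closed[OF grp] stay_carrier[OF z] by (intro bexI[of _ \<one>]) auto
  next
    case (Suc k)
    then obtain y where y: "y \<in> ?P" "inv y \<otimes> z \<in> stay K {- int m..<int k}" by blast
    have "inv y \<otimes> z \<in> stay K {int k - int m..<int k}"
      using y(2) by (rule stay_antimono) auto
    from step[OF this] obtain u where u: "u \<in> stay K {..<int k}"
      "inv u \<otimes> (inv y \<otimes> z) \<in> stay K {int k - int m..<int k + 1}" by blast
    note car = stay_carrier[OF y(1)] stay_carrier[OF u(1)] stay_carrier[OF z]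
    \<comment> \<open>\<open>u\<close> stays in \<open>K\<close> at every time before
      \<open>k\<close>, so dividing by it keeps what was already achieved at those times.\<close>
    have "u \<in> stay K {- int m..<int k}"
      using u(1) by (rule stay_antimono) auto
    then have "inv u \<otimes> (inv y \<otimes> z) \<in> stay K {- int m..<int k}"
      using subgroup.m_closed[OF grp subgroup.m_inv_closed[OF grp] y(2)] by blast
    then have "inv u \<otimes> (inv y \<otimes> z) \<in> stay K {- int m..<int (Suc k)}"
      using stay_extend[of _ K "- int m" "int k"] stayD[OF u(2), of "int k"]
      by (simp add: add.commute m_def)
    moreover have "inv u \<otimes> (inv y \<otimes> z) = inv (y \<otimes> u) \<otimes> z"
      using car by (simp add: inv_mult_group m_assoc)
    moreover have "u \<in> ?P"
      using u(1) by (rule stay_antimono) auto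
    then have "y \<otimes> u \<in> ?P" using y(1) subgroup.m_closed[OF grp] by blast
    ultimately show ?case by metis
  qed
  have "\<exists>y\<in>?P. inv y \<otimes> z \<in> stay K {- int m..}" if z: "z \<in> stay K {- int m..<0}" for z
  proof -
    have zG: "z \<in> carrier G" using z by (rule stay_carrier)
    \<comment> \<open>A \<open>y\<close> in \<open>?P\<close> works up to time \<open>k\<close> iff
      it lies in \<open>?C k\<close>, by inversion in a subgroup (\<open>mem\<close>). A point
      common to \<open>?P\<close> and all \<open>?C k\<close> works for all times.\<close>
    let ?C = "\<lambda>k. (\<lambda>x. z \<otimes> x) ` stay K {- int m..<int k}"
    have Un': "(\<Union>k. {- int m..<int k}) = {- int m..}"
    proof -
      have "i \<in> {- int m..<int (Suc (nat i))}" if "- int m \<le> i" for i using that by simp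
      then show ?thesis by fastforce
    qed
    have mem: "inv z \<otimes> y \<in> S \<longleftrightarrow> inv y \<otimes> z \<in> S" if "subgroup S G" "y \<in> carrier G" for S y
    proof -
      have "inv (inv z \<otimes> y) = inv y \<otimes> z" "inv (inv y \<otimes> z) = inv z \<otimes> y"
        using that(2) zG by (simp_all add: inv_mult_group)
      then show ?thesis using subgroup.m_inv_closed[OF that(1)] by metis
    qed
    have "?P \<inter> (\<Inter>k. ?C k) \<noteq> {}"
    proof (rule decseq_compactin_meets_closed)
      show "decseq ?C"
        unfolding decseq_def by (intro allI impI image_mono stay_mono) auto
      show "closedin T (?C k)" for k using cl zG by (rule closedin_l_translate)
      have "continuous_map T T (\<lambda>x. z \<otimes> x)"
        using homeomorphic_map_l_translation[OF zG] by (rule homeomorphic_imp_continuous_map)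
      moreover have "compactin T (stay K {- int m..<int 0})"
        using compactin_stay[OF K(2), of "- 1"] by (simp add: m_def)
      ultimately show "compactin T (?C 0)" by (intro image_compactin)
      show "closedin T ?P" by (rule cl)
      show "?P \<inter> ?C k \<noteq> {}" for k
      proof -
        obtain y where y: "y \<in> ?P" "inv y \<otimes> z \<in> stay K {- int m..<int k}"
          using fwd[OF z] by blast
        have yG: "y \<in> carrier G" using y(1) by (rule stay_carrier)
        have "y = z \<otimes> (inv z \<otimes> y)" using yG zG by (simp add: m_assoc[symmetric])
        then have "y \<in> ?C k" using y(2) mem[OF grp yG] by blast
        then show ?thesis using y(1) by blast
      qed
    qed simp
    then obtain y where y: "y \<in> ?P" and y': "y \<in> (\<Inter>k. ?C k)" by blast
    have yC: "y \<in> ?C k" for k using y' by (rule INT_D) (rule UNIV_I)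
    have yG: "y \<in> carrier G" using y by (rule stay_carrier)
    have "inv z \<otimes> y \<in> stay K {- int m..<int k}" for k
    proof -
      obtain s where s: "s \<in> stay K {- int m..<int k}" "y = z \<otimes> s" using yC by blast
      then have "inv z \<otimes> y = s" using zG stay_carrier[OF s(1)] by (simp add: m_assoc[symmetric])
      then show ?thesis using s(1) by simp
    qed
    then have "inv z \<otimes> y \<in> (\<Inter>k. stay K {- int m..<int k})" by blast
    then have "inv z \<otimes> y \<in> stay K {- int m..}" unfolding stay_Union Un' .
    then show ?thesis using y mem[OF grp yG] by blast
  qed
  then show ?thesis using that[of m] by (simp add: m_def)
qed

text \<open>
  A shadowing argument: if the orbit of \<open>x\<close> stays in \<open>V N\<close>, then \<open>x\<close> is modified by elements of
  \<open>N\<close> so that longer and longer pieces of its orbit stay in \<open>W\<close>. Extending the piece by one step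
  creates an error in \<open>N \<inter> W\<close>; its factorization allows pushing one factor into the past, where it
  is harmless, while the other one remains harmless in the future.
\<close>

lemma quotient_expansive_neighbourhood:
  assumes N: "N \<lhd> G" "closedin T N" "\<alpha> ` N = N"
    and W: "subgroup W G" "openin T W" "compactin T W"
    and exp: "\<And>x. x \<in> carrier G \<Longrightarrow> (\<And>n. iter n x \<in> W) \<Longrightarrow> x = \<one>"
  obtains V where "openin T V" "\<one> \<in> V"
    "\<And>x. x \<in> carrier G \<Longrightarrow> (\<And>n. \<exists>v\<in>V. \<exists>h\<in>N. iter n x = v \<otimes> h) \<Longrightarrow> x \<in> N"
proof -
  interpret N: normal N G by fact
  have iN: "iter n x \<in> N" if "x \<in> N" for n x
    using iter_image_subset[OF N(3) N.subset that] .
  define K where "K = N \<inter> W"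
  have KW: "K \<subseteq> W" and KN: "K \<subseteq> N" by (auto simp: K_def)
  have K: "subgroup K G"
    unfolding K_def using N.subgroup_axioms W(1) by (rule subgroups_Inter_pair)
  have "compactin T K"
    unfolding K_def using N(2) W(3) by (rule closed_Int_compactin)
  \<comment> \<open>\<open>N\<close> is invariant, so \<open>\<alpha>\<close> can move an element of
    \<open>K\<close> out of \<open>K\<close> only by moving it out of \<open>W\<close>.\<close>
  moreover have "iter 1 ` K \<inter> W \<subseteq> K" using iN by (auto simp: K_def)
  moreover have "\<one> \<in> W" using W(1) by (rule subgroup.one_closed)
  ultimately obtain m :: nat where m: "m > 0" and
    fact: "\<And>z. z \<in> stay K {- int m..<0} \<Longrightarrow>
      \<exists>y\<in>stay K {..<0}. inv y \<otimes> z \<in> stay K {- int m..}"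
    using tidy_factorization[OF K _ W(2)] by blast
  \<comment> \<open>Time \<open>0\<close> is included so that for \<open>v\<close> in
    \<open>V\<close> both \<open>v\<close> and \<open>iter 1 v\<close> stay in \<open>W\<close>
    throughout \<open>{- int m..<0}\<close>.\<close>
  define V where "V = stay W {- int m..<1}"
  \<comment> \<open>\<open>\<alpha>\<close> maps \<open>Q\<close> into itself, so an error in
    \<open>Q\<close> remains harmless later.\<close>
  define Q where "Q = stay K {- int m..}"
  note grpW = subgroup_stay[OF W(1)]
  note grpK = subgroup_stay[OF K]
  \<comment> \<open>Invariant of the shadowing: the modified orbit is in \<open>W\<close> before
    time \<open>M\<close>, and at time \<open>M\<close> it differs from \<open>V\<close> only by a
    factor in \<open>Q\<close>.\<close>
  have past: "\<exists>n\<in>N. x \<otimes> n \<in> stay W {- int m..<int M} \<and>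
      (\<exists>v\<in>V. \<exists>q\<in>Q. iter (int M) (x \<otimes> n) = v \<otimes> q)"
    if x: "x \<in> carrier G" and hx: "\<And>n. \<exists>v\<in>V. \<exists>h\<in>N. iter n x = v \<otimes> h" for x and M :: nat
  proof (induction M)
    case 0
    obtain v h where vh: "v \<in> V" "h \<in> N" "iter 0 x = v \<otimes> h" using hx by blast
    have vG: "v \<in> carrier G" using vh(1) unfolding V_def by (rule stay_carrier)
    have "x \<otimes> inv h = v" using vh x vG by (simp add: m_assoc)
    moreover have "\<one> \<in> Q" unfolding Q_def using grpK by (rule subgroup.one_closed)
    moreover have "v \<in> stay W {- int m..<0}"
      using vh(1) unfolding V_def by (rule stay_antimono) auto
    moreover have "iter (int 0) v = v \<otimes> \<one>" using vG by simp
    ultimately show ?case using vh(1,2) by (intro bexI[of _ "inv h"]) auto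
  next
    case (Suc M)
    then obtain n v q where n: "n \<in> N" and stay: "x \<otimes> n \<in> stay W {- int m..<int M}"
      and v: "v \<in> V" and q: "q \<in> Q" and vq: "iter (int M) (x \<otimes> n) = v \<otimes> q" by blast
    obtain v' h' where v': "v' \<in> V" and h': "h' \<in> N" and vh': "iter (int M + 1) x = v' \<otimes> h'"
      using hx by blast
    have G: "v \<in> carrier G" "v' \<in> carrier G" "q \<in> carrier G" "x \<otimes> n \<in> carrier G"
      using v v' q x n unfolding V_def Q_def by (auto intro: stay_carrier)
    \<comment> \<open>The error at time \<open>M + 1\<close> relative to \<open>v'\<close>.
      Comparison with the image under \<open>\<alpha>\<close> of the decomposition at time
      \<open>M\<close> shows that it stays in \<open>W\<close>, hence in \<open>K\<close>, during
      \<open>{- int m..<0}\<close>.\<close>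
    define h where "h = h' \<otimes> iter (int M + 1) n"
    have hN: "h \<in> N" unfolding h_def using h' iN[OF n] by (rule N.m_closed)
    then have hG: "h \<in> carrier G" by simp
    have hv: "iter (int M + 1) (x \<otimes> n) = v' \<otimes> h"
      using x n h' G by (simp add: vh' h_def m_assoc)
    also have "iter (int M + 1) (x \<otimes> n) = iter 1 (iter (int M) (x \<otimes> n))"
      using G by (simp add: add.commute)
    finally have "v' \<otimes> h = iter 1 v \<otimes> iter 1 q" using G by (simp add: vq)
    then have heq: "h = inv v' \<otimes> (iter 1 v \<otimes> iter 1 q)"
      using G hG by (metis inv_solve_left iter_closed m_closed)
    have "iter 1 v \<in> stay W {- int m..<0}"
      using v G by (auto simp: V_def stay_def)
    moreover have "iter 1 q \<in> stay W {- int m..<0}"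
      using q G KW by (auto simp: Q_def stay_def)
    moreover have "v' \<in> stay W {- int m..<0}"
      using v' unfolding V_def by (rule stay_antimono) auto
    ultimately have "h \<in> stay W {- int m..<0}"
      unfolding heq by (intro subgroup.m_closed[OF grpW] subgroup.m_inv_closed[OF grpW])
    then have "h \<in> stay K {- int m..<0}"
      using iN[OF hN] by (auto simp: stay_def K_def)
    \<comment> \<open>The inverse is factorized because the correction \<open>p\<close> has to
      appear on the right of \<open>h\<close>.\<close>
    then have "inv h \<in> stay K {- int m..<0}" by (rule subgroup.m_inv_closed[OF grpK])
    from fact[OF this] obtain p where p: "p \<in> stay K {..<0}"
      and r: "inv p \<otimes> inv h \<in> stay K {- int m..}" by blast
    have pG: "p \<in> carrier G" using p by (rule stay_carrier)
    have "inv (inv p \<otimes> inv h) = h \<otimes> p" using pG hG by (simp add: inv_mult_group)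
    then have hp: "h \<otimes> p \<in> Q"
      unfolding Q_def using subgroup.m_inv_closed[OF grpK r] by simp
    \<comment> \<open>Transported to time \<open>0\<close>, the correction stays in \<open>K\<close>
      at all times up to \<open>M\<close>, and at time \<open>M + 1\<close> it replaces the error
      \<open>h\<close> by \<open>h \<otimes> p\<close>.\<close>
    let ?p = "iter (- (int M + 1)) p"
    have "?p \<in> K" using p by (rule stayD) simp
    then have pN: "?p \<in> N" using KN by blast
    have "iter (int M) (x \<otimes> n) \<in> W"
    proof -
      have "v \<in> W" using v stayD[of v W "{- int m..<1}" 0] G by (simp add: V_def)
      moreover have "q \<in> W" using q stayD[of q K "{- int m..}" 0] G KW by (auto simp: Q_def)
      ultimately show ?thesis unfolding vq by (rule subgroup.m_closed[OF W(1)])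
    qed
    then have "x \<otimes> n \<in> stay W {- int m..<int (Suc M)}"
      using stay_extend[OF stay] by (simp add: add.commute)
    moreover have "?p \<in> stay W {- int m..<int (Suc M)}"
      using p pG KW by (auto simp: stay_def)
    ultimately have "(x \<otimes> n) \<otimes> ?p \<in> stay W {- int m..<int (Suc M)}"
      by (rule subgroup.m_closed[OF grpW])
    moreover have "iter (int (Suc M)) ((x \<otimes> n) \<otimes> ?p) = v' \<otimes> (h \<otimes> p)"
    proof -
      have "iter (int (Suc M)) ((x \<otimes> n) \<otimes> ?p) = iter (int M + 1) (x \<otimes> n) \<otimes> p"
        using G pG by (simp add: add.commute)
      then show ?thesis using G hG pG by (simp add: hv m_assoc)
    qed
    moreover have "(x \<otimes> n) \<otimes> ?p = x \<otimes> (n \<otimes> ?p)" using x n pG by (simp add: m_assoc)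
    ultimately show ?case using v' hp N.m_closed[OF n pN] by metis
  qed
  have "x \<in> N" if x: "x \<in> carrier G" and hx: "\<And>n. \<exists>v\<in>V. \<exists>h\<in>N. iter n x = v \<otimes> h" for x
  proof -
    \<comment> \<open>A symmetric window comes from applying \<open>past\<close> to
      \<open>iter (- int M) x\<close> for \<open>2 * M\<close> steps and shifting back; the
      hypothesis on \<open>x\<close> covers all integers, so it passes to this point.\<close>
    have window: "\<exists>n\<in>N. x \<otimes> n \<in> stay W {- int M..<int M}" for M :: nat
    proof -
      have "\<exists>v\<in>V. \<exists>h\<in>N. iter n (iter (- int M) x) = v \<otimes> h" for n
        using hx[of "n - int M"] x by simp
      then obtain n where n: "n \<in> N"
        and s: "iter (- int M) x \<otimes> n \<in> stay W {- int m..<int (2 * M)}"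
        using past[of "iter (- int M) x" "2 * M"] x by auto
      have "iter (int M) (iter (- int M) x \<otimes> n) \<in> stay W {- int M..<int M}"
        using s x n by (auto simp: stay_def simp del: iter_mult)
      then show ?thesis using x n iN[OF n] by auto
    qed
    \<comment> \<open>With \<open>Suc\<close>, already the first window contains time
      \<open>0\<close>, which makes \<open>?C 0\<close> compact.\<close>
    let ?C = "\<lambda>M. stay W {- int (Suc M)..<int (Suc M)}"
    have "(\<lambda>n. x \<otimes> n) ` N \<inter> (\<Inter>M. ?C M) \<noteq> {}"
    proof (rule decseq_compactin_meets_closed)
      show "decseq ?C" unfolding decseq_def by (intro allI impI stay_mono) auto
      show "closedin T (?C M)" for M
        using closedin_open_subgroup[OF W(1,2)] by (rule closedin_stay)
      show "compactin T (?C 0)" using compactin_stay[OF W(3), of 0] by simp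
      show "closedin T ((\<lambda>n. x \<otimes> n) ` N)" using N(2) x by (rule closedin_l_translate)
      show "(\<lambda>n. x \<otimes> n) ` N \<inter> ?C M \<noteq> {}" for M using window[of "Suc M"] by blast
    qed simp
    then obtain n where n: "n \<in> N" "\<And>M. x \<otimes> n \<in> ?C M" by blast
    have "iter i (x \<otimes> n) \<in> W" for i
      using n(2)[of "nat \<bar>i\<bar>"] by (rule stayD) auto
    then have "x \<otimes> n = \<one>" using x n(1) by (intro exp) auto
    then have "x = inv n" using x n(1) by (simp add: inv_equality)
    then show "x \<in> N" using n(1) by simp
  qed
  moreover have "openin T V" unfolding V_def using W(2) by (intro openin_stay) auto
  moreover have "\<one> \<in> V" unfolding V_def using grpW by (rule subgroup.one_closed)
  ultimately show ?thesis using that by blast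
qed

end

section \<open>Expansiveness on \<open>G\<close>, on \<open>N\<close> and on the quotient\<close>

theorem theoremA:
  fixes G :: "('a, 'b) monoid_scheme" and T :: "'a topology"
    and \<alpha> :: "'a \<Rightarrow> 'a" and N :: "'a set"
  assumes "topological_group G T"
    and "totally_disconnected_space T"
    and "locally_compact_space T"
    and "topological_automorphism G T \<alpha>"
    and "N \<lhd> G"
    and "closedin T N"
    and "\<alpha> ` N = N"
  shows "expansive G T \<alpha> \<longleftrightarrow>
    expansive (G\<lparr>carrier := N\<rparr>) (subtopology T N) (restrict \<alpha> N) \<and>
    expansive (G Mod N) (coset_topology G T N) (induced_automorphism G N \<alpha>)"
proof -
  interpret topological_group_automorphism G T \<alpha>
    using assms(1,4)
    by (simp add: topological_group_automorphism_def topological_group_automorphism_axioms_def)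
  interpret N: normal N G by fact
  let ?N = "G\<lparr>carrier := N\<rparr>" and ?Q = "G Mod N"
  let ?aN = "restrict \<alpha> N" and ?aQ = "induced_automorphism G N \<alpha>"
  have gN: "group ?N" using N.subgroup_is_group is_group by blast
  have gQ: "group ?Q" by (rule N.factorgroup_is_group)
  have aN: "?aN \<in> auto ?N"
    using topological_automorphism_restrict[OF assms(1,4) N.subgroup_axioms assms(7)]
    by (simp add: topological_automorphism_def)
  have aQ: "?aQ \<in> auto ?Q"
    using topological_automorphism_induced[OF assms(1,4,5,7)]
    by (simp add: topological_automorphism_def)
  have iter_N: "(?aN [^]\<^bsub>AutoGroup ?N\<^esub> n) x = iter n x" if "x \<in> N" for x and n :: int
    using group.auto_int_pow_intertwine[OF gN is_group aN in_auto, of "\<lambda>x. x" x n] that N.subset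
    by (auto simp: iter_def)
  have iter_Q: "(?aQ [^]\<^bsub>AutoGroup ?Q\<^esub> n) (N #>\<^bsub>G\<^esub> x) = N #>\<^bsub>G\<^esub> iter n x"
    if "x \<in> carrier G" for x and n :: int
    using auto_int_pow_intertwine[OF gQ in_auto aQ, of "\<lambda>x. N #>\<^bsub>G\<^esub> x" x n] that
      induced_automorphism_r_coset[OF assms(5) in_auto assms(7)]
    by (auto simp: iter_def carrier_FactGroup)
  have coset_N: "N #>\<^bsub>G\<^esub> x = N \<longleftrightarrow> x \<in> N" if "x \<in> carrier G" for x
    using that coset_join1[OF _ _ N.subgroup_axioms] N.rcos_const[OF is_group] by blast
  \<comment> \<open>All three conditions are stated for \<open>iter\<close> on elements of
    \<open>G\<close>; in the quotient, a trivial coset becomes an element of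
    \<open>N\<close>.\<close>
  have exp_G: "expansive G T \<alpha> \<longleftrightarrow> (\<exists>U. identity_neighbourhood G T U \<and>
      (\<forall>x\<in>carrier G. (\<forall>n. iter n x \<in> U) \<longrightarrow> x = \<one>\<^bsub>G\<^esub>))"
    unfolding iter_def using in_auto by (rule expansive_iff)
  have exp_N: "expansive ?N (subtopology T N) ?aN \<longleftrightarrow>
      (\<exists>U. identity_neighbourhood ?N (subtopology T N) U \<and>
        (\<forall>x\<in>N. (\<forall>n. iter n x \<in> U) \<longrightarrow> x = \<one>\<^bsub>G\<^esub>))"
    using group.expansive_iff[OF gN aN, of "subtopology T N"] by (simp add: iter_N cong: ball_cong)
  have exp_Q: "expansive ?Q (coset_topology G T N) ?aQ \<longleftrightarrow>
      (\<exists>U. identity_neighbourhood ?Q (coset_topology G T N) U \<and>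
        (\<forall>x\<in>carrier G. (\<forall>n. N #>\<^bsub>G\<^esub> iter n x \<in> U) \<longrightarrow> x \<in> N))"
    using group.expansive_iff[OF gQ aQ, of "coset_topology G T N"]
    by (simp add: carrier_FactGroup iter_Q coset_N cong: ball_cong)
  show ?thesis
  proof
    assume "expansive G T \<alpha>"
    then obtain U where "identity_neighbourhood G T U"
      and "\<forall>x\<in>carrier G. (\<forall>n. iter n x \<in> U) \<longrightarrow> x = \<one>\<^bsub>G\<^esub>"
      unfolding exp_G by blast
    then obtain V\<^sub>0 where U: "V\<^sub>0 \<subseteq> U" "openin T V\<^sub>0" "\<one>\<^bsub>G\<^esub> \<in> V\<^sub>0"
      and exp: "\<And>x. x \<in> carrier G \<Longrightarrow> (\<And>n. iter n x \<in> U) \<Longrightarrow> x = \<one>\<^bsub>G\<^esub>"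
      by (auto simp: identity_neighbourhood_def)
    have "openin (subtopology T N) (V\<^sub>0 \<inter> N)"
      using U(2) by (auto simp: openin_subtopology)
    then have "identity_neighbourhood ?N (subtopology T N) (V\<^sub>0 \<inter> N)"
      using U(3) N.one_closed unfolding identity_neighbourhood_def by auto
    moreover have "x = \<one>\<^bsub>G\<^esub>" if "x \<in> N" "\<forall>n. iter n x \<in> V\<^sub>0 \<inter> N" for x
      using that U(1) N.subset by (intro exp) auto
    ultimately have "expansive ?N (subtopology T N) ?aN" unfolding exp_N by blast
    moreover obtain W where W: "subgroup W G" "openin T W" "compactin T W" "W \<subseteq> V\<^sub>0"
      using compact_open_subgroup_base[OF assms(2,3) U(2,3)] by blast
    have expW: "x = \<one>\<^bsub>G\<^esub>" if "x \<in> carrier G" "\<And>n. iter n x \<in> W" for x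
      using that W(4) U(1) by (intro exp) auto
    obtain V where V: "openin T V" "\<one>\<^bsub>G\<^esub> \<in> V"
      and inN: "\<And>x. x \<in> carrier G \<Longrightarrow>
        (\<And>n. \<exists>v\<in>V. \<exists>h\<in>N. iter n x = v \<otimes>\<^bsub>G\<^esub> h) \<Longrightarrow> x \<in> N"
      using quotient_expansive_neighbourhood[OF assms(5-7) W(1-3) expW] by blast
    have VG: "V \<subseteq> carrier G" using openin_subset[OF V(1)] by (simp add: topspace_eq)
    let ?V = "(\<lambda>g. N #>\<^bsub>G\<^esub> g) ` V"
    have mem: "\<exists>v\<in>V. x \<in> N #>\<^bsub>G\<^esub> v" if "x \<in> carrier G" "N #>\<^bsub>G\<^esub> x \<in> ?V" for x
      using that rcos_self[OF _ N.subgroup_axioms] by blast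
    \<comment> \<open>The preimage of \<open>?V\<close> is the product of \<open>N\<close> and
      \<open>V\<close>, a union of open translates, so \<open>?V\<close> is open in the
      quotient.\<close>
    have "{x \<in> topspace T. N #>\<^bsub>G\<^esub> x \<in> ?V} = (\<Union>h\<in>N. (\<lambda>v. h \<otimes>\<^bsub>G\<^esub> v) ` V)"
    proof (rule equalityI; rule subsetI)
      fix x assume "x \<in> {x \<in> topspace T. N #>\<^bsub>G\<^esub> x \<in> ?V}"
      then show "x \<in> (\<Union>h\<in>N. (\<lambda>v. h \<otimes>\<^bsub>G\<^esub> v) ` V)"
        using mem[of x] by (auto simp: topspace_eq r_coset_def)
    next
      fix x assume "x \<in> (\<Union>h\<in>N. (\<lambda>v. h \<otimes>\<^bsub>G\<^esub> v) ` V)"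
      then obtain h v where hv: "h \<in> N" "v \<in> V" "x = h \<otimes>\<^bsub>G\<^esub> v" by blast
      then have "x \<in> N #>\<^bsub>G\<^esub> v" "v \<in> carrier G" using VG by (auto simp: r_coset_def)
      then have "N #>\<^bsub>G\<^esub> v = N #>\<^bsub>G\<^esub> x" using N.subgroup_axioms by (rule repr_independence)
      then show "x \<in> {x \<in> topspace T. N #>\<^bsub>G\<^esub> x \<in> ?V}"
        using hv VG by (auto simp: topspace_eq)
    qed
    moreover have "openin T (\<Union>h\<in>N. (\<lambda>v. h \<otimes>\<^bsub>G\<^esub> v) ` V)"
      using openin_l_translate[OF V(1)] N.subset by blast
    ultimately have "openin (coset_topology G T N) ?V"
      using VG by (auto simp: coset_topology_def openin_quotient_topology topspace_eq)
    moreover have "\<one>\<^bsub>?Q\<^esub> \<in> ?V" using V(2) coset_N[of "\<one>\<^bsub>G\<^esub>"] by force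
    moreover have "?V \<subseteq> carrier ?Q" using VG by (auto simp: carrier_FactGroup)
    ultimately have "identity_neighbourhood ?Q (coset_topology G T N) ?V"
      unfolding identity_neighbourhood_def by blast
    moreover have "x \<in> N" if x: "x \<in> carrier G" "\<forall>n. N #>\<^bsub>G\<^esub> iter n x \<in> ?V" for x
    proof (rule inN[OF x(1)])
      fix n
      obtain v where v: "v \<in> V" "iter n x \<in> N #>\<^bsub>G\<^esub> v" using mem[of "iter n x"] x by auto
      \<comment> \<open>Normality exchanges the right coset for a left one, which has the order of
        factors required by \<open>inN\<close>.\<close>
      then have "iter n x \<in> v <#\<^bsub>G\<^esub> N" using N.coset_eq VG by auto
      then show "\<exists>v\<in>V. \<exists>h\<in>N. iter n x = v \<otimes>\<^bsub>G\<^esub> h" using v(1) by (auto simp: l_coset_def)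
    qed
    ultimately have "expansive ?Q (coset_topology G T N) ?aQ" unfolding exp_Q by blast
    with \<open>expansive ?N (subtopology T N) ?aN\<close>
    show "expansive ?N (subtopology T N) ?aN \<and> expansive ?Q (coset_topology G T N) ?aQ" ..
  next
    assume *: "expansive ?N (subtopology T N) ?aN \<and> expansive ?Q (coset_topology G T N) ?aQ"
    obtain U\<^sub>N where "identity_neighbourhood ?N (subtopology T N) U\<^sub>N"
      and exp_U\<^sub>N: "\<forall>x\<in>N. (\<forall>n. iter n x \<in> U\<^sub>N) \<longrightarrow> x = \<one>\<^bsub>G\<^esub>"
      using *[THEN conjunct1] unfolding exp_N by blast
    then obtain V\<^sub>N where N: "openin (subtopology T N) V\<^sub>N" "\<one>\<^bsub>G\<^esub> \<in> V\<^sub>N" "V\<^sub>N \<subseteq> U\<^sub>N"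
      by (auto simp: identity_neighbourhood_def)
    obtain U\<^sub>Q where "identity_neighbourhood ?Q (coset_topology G T N) U\<^sub>Q"
      and exp_U\<^sub>Q: "\<forall>x\<in>carrier G. (\<forall>n. N #>\<^bsub>G\<^esub> iter n x \<in> U\<^sub>Q) \<longrightarrow> x \<in> N"
      using *[THEN conjunct2] unfolding exp_Q by blast
    then obtain V\<^sub>Q where Q: "openin (coset_topology G T N) V\<^sub>Q" "N \<in> V\<^sub>Q" "V\<^sub>Q \<subseteq> U\<^sub>Q"
      by (auto simp: identity_neighbourhood_def)
    \<comment> \<open>\<open>B\<close> extends \<open>V\<^sub>N\<close> to an open set of
      \<open>G\<close>, and \<open>?P\<close> is the preimage of \<open>V\<^sub>Q\<close>. An orbit
      inside \<open>?P\<close> forces its point into \<open>N\<close>; being also inside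
      \<open>B\<close>, it then lies in \<open>V\<^sub>N\<close>.\<close>
    obtain B where B: "openin T B" "V\<^sub>N = B \<inter> N" using N(1) by (auto simp: openin_subtopology)
    let ?P = "{x \<in> topspace T. N #>\<^bsub>G\<^esub> x \<in> V\<^sub>Q}"
    have "openin T (B \<inter> ?P)"
      using Q(1) B(1) by (auto simp: coset_topology_def openin_quotient_topology)
    moreover have "\<one>\<^bsub>G\<^esub> \<in> B \<inter> ?P"
      using N(2) B(2) Q(2) coset_N[of "\<one>\<^bsub>G\<^esub>"] by (auto simp: topspace_eq)
    ultimately have "identity_neighbourhood G T (B \<inter> ?P)"
      by (auto simp: identity_neighbourhood_def topspace_eq)
    moreover have "x = \<one>\<^bsub>G\<^esub>" if x: "x \<in> carrier G" "\<forall>n. iter n x \<in> B \<inter> ?P" for x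
    proof -
      have "\<forall>n. N #>\<^bsub>G\<^esub> iter n x \<in> U\<^sub>Q" using x(2) Q(3) by blast
      then have "x \<in> N" using x(1) exp_U\<^sub>Q by blast
      then have "iter n x \<in> V\<^sub>N" for n
        using x(2) B(2) iter_image_subset[OF assms(7) N.subset] by blast
      then show ?thesis using \<open>x \<in> N\<close> N(3) exp_U\<^sub>N by blast
    qed
    ultimately show "expansive G T \<alpha>" unfolding exp_G by blast
  qed
qed

end
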